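(* Let $G$ be a topological group admitting a complete metric (i.e. the topology of $G$ is defined by some complete metric). Then there is a left-invariant metric $d$ on $G$ defining the topology of $G$ such that $(G,d)$ is a continuous metric $L$-structure if and only if $G$ is a SIN-group.
   Context: Let $L=\{d,\cdot,{}^{-1}\}$. A continuous metric $L$-structure on a group $G$ is a complete metric space $(G,d)$ with $d\le 1$ such that the group operations $\cdot$ and ${}^{-1}$ are uniformly continuous: there are moduli $\gamma_1,\gamma_2$ such that for every $\varepsilon>0$, $d(x_1,x_2)<\gamma_1(\varepsilon)$ implies $d(x_1^{-1},x_2^{-1})<\varepsilon$, and $d(x_1,x_2)<\gamma_2(\varepsilon)$ implies $\max(d(x_1 y,x_2 y),d(y x_1,y x_2))<\varepsilon$ for all $y\in G$. A topological group $G$ is a SIN-group if every neighbourhood of the identity contains a neighbourhood of the identity which is invariant under all inner automorphisms of $G$. *)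

theory Defs
  imports "HOL-Analysis.Analysis" "HOL-Algebra.Group"
begin

locale topological_group = group G
  for G (structure) and T :: "'a topology" +
  assumes topspace_eq: "topspace T = carrier G"
    and continuous_mult: "continuous_map (prod_topology T T) T (\<lambda>(x, y). x \<otimes> y)"
    and continuous_inv: "continuous_map T T (\<lambda>x. inv x)"

text \<open>Neighbourhoods are not required to be open.\<close>

definition neighbourhood :: "'a topology \<Rightarrow> 'a \<Rightarrow> 'a set \<Rightarrow> bool"
  where "neighbourhood T x U \<longleftrightarrow> U \<subseteq> topspace T \<and> (\<exists>W. openin T W \<and> x \<in> W \<and> W \<subseteq> U)"

definition invariant_under_inner :: "('a, 'b) monoid_scheme \<Rightarrow> 'a set \<Rightarrow> bool"
  where "invariant_under_inner G V \<longleftrightarrow>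
    (\<forall>g\<in>carrier G. (\<lambda>x. g \<otimes>\<^bsub>G\<^esub> x \<otimes>\<^bsub>G\<^esub> inv\<^bsub>G\<^esub> g) ` V = V)"

definition SIN_group :: "('a, 'b) monoid_scheme \<Rightarrow> 'a topology \<Rightarrow> bool"
  where "SIN_group G T \<longleftrightarrow> topological_group G T \<and>
    (\<forall>U. neighbourhood T \<one>\<^bsub>G\<^esub> U \<longrightarrow>
      (\<exists>V. neighbourhood T \<one>\<^bsub>G\<^esub> V \<and> V \<subseteq> U \<and> invariant_under_inner G V))"

definition left_invariant :: "('a, 'b) monoid_scheme \<Rightarrow> ('a \<Rightarrow> 'a \<Rightarrow> real) \<Rightarrow> bool"
  where "left_invariant G d \<longleftrightarrow>
    (\<forall>g\<in>carrier G. \<forall>x\<in>carrier G. \<forall>y\<in>carrier G. d (g \<otimes>\<^bsub>G\<^esub> x) (g \<otimes>\<^bsub>G\<^esub> y) = d x y)"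

definition is_modulus :: "(real \<Rightarrow> real) \<Rightarrow> bool"
  where "is_modulus \<gamma> \<longleftrightarrow> (\<forall>\<epsilon>>0. \<gamma> \<epsilon> > 0)"

text \<open>A modulus for multiplication bounds both translations, uniformly in the translating
  element; it is a modulus in each variable separately.\<close>

locale continuous_metric_group_structure = group G + Metric_space "carrier G" d
  for G (structure) and d :: "'a \<Rightarrow> 'a \<Rightarrow> real" +
  assumes complete: "mcomplete"
    and bounded: "\<lbrakk>x \<in> carrier G; y \<in> carrier G\<rbrakk> \<Longrightarrow> d x y \<le> 1"
    and uniform_inv: "\<exists>\<gamma>\<^sub>1. is_modulus \<gamma>\<^sub>1 \<and>
      (\<forall>\<epsilon>>0. \<forall>x\<^sub>1\<in>carrier G. \<forall>x\<^sub>2\<in>carrier G.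
        d x\<^sub>1 x\<^sub>2 < \<gamma>\<^sub>1 \<epsilon> \<longrightarrow> d (inv x\<^sub>1) (inv x\<^sub>2) < \<epsilon>)"
    and uniform_mult: "\<exists>\<gamma>\<^sub>2. is_modulus \<gamma>\<^sub>2 \<and>
      (\<forall>\<epsilon>>0. \<forall>x\<^sub>1\<in>carrier G. \<forall>x\<^sub>2\<in>carrier G. d x\<^sub>1 x\<^sub>2 < \<gamma>\<^sub>2 \<epsilon> \<longrightarrow>
        (\<forall>y\<in>carrier G. max (d (x\<^sub>1 \<otimes> y) (x\<^sub>2 \<otimes> y)) (d (y \<otimes> x\<^sub>1) (y \<otimes> x\<^sub>2)) < \<epsilon>))"

end

theory Submission
  imports Defs
begin

text \<open>
  If \<open>d\<close> is left-invariant and right translations are uniformly equicontinuous, then conjugation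
  \<open>x \<mapsto> g x g\<^sup>-\<^sup>1\<close> moves the points near \<open>\<one>\<close> by an amount that does not depend on \<open>g\<close>. Hence the
  union of all conjugates of a small ball about \<open>\<one>\<close> stays in a prescribed ball, and this union is an
  invariant neighbourhood (\<open>SIN_if_continuous_left_invariant_metric\<close>).

  Conversely, a metrizable SIN-group has a base \<open>V 0 \<supseteq> V 1 \<supseteq> \<dots>\<close> of symmetric, conjugation-invariant
  neighbourhoods of \<open>\<one>\<close> with \<open>V (n+1) V (n+1) V (n+1) \<subseteq> V n\<close>
  (\<open>SIN_neighbourhood_chain\<close>). The construction of Birkhoff and Kakutani turns such a base into a
  metric: give \<open>x\<close> the weight \<open>inf {2\<^sup>-\<^sup>n | x \<in> V n}\<close>, and let the norm of \<open>x\<close> be the infimum of the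
  total weights of all factorizations of \<open>x\<close>. The norm is subadditive by construction, and Frink's splitting
  argument bounds the weight by twice the norm (\<open>weight_chain_prod_le\<close>), so that the norm still
  generates the topology. As the sets \<open>V n\<close> are conjugation-invariant, so is the norm, and
  the metric \<open>d x y = norm (x\<^sup>-\<^sup>1 y)\<close> is invariant on both sides. For a bi-invariant metric
  inversion and all translations are isometries, and both moduli can be the identity.

  It remains to see that \<open>d\<close> is complete, although only some other metric \<open>\<rho>\<close> for the same topology
  is known to be so (\<open>mcomplete_if_completely_metrizable\<close>, a result of Klee). In the
  completion of \<open>G\<close>, which is again a group, \<open>G\<close> is a dense \<open>G\<^sub>\<delta>\<close> set; any two of its cosets
  must meet by Baire's theorem, so there is only one coset. The proof below runs this
  argument inside \<open>G\<close>: for a \<open>d\<close>-Cauchy sequence \<open>x\<close>, Baire's theorem gives a \<open>g\<close> for which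
  \<open>x n g\<close> is \<open>\<rho>\<close>-Cauchy, and if \<open>x n g\<close> tends to \<open>z\<close>, then \<open>x n\<close> tends to \<open>z g\<^sup>-\<^sup>1\<close>.
\<close>

section \<open>The chain norm of a weight\<close>

lemma (in group) inv_cancel_left:
  "\<lbrakk>g \<in> carrier G; x \<in> carrier G\<rbrakk> \<Longrightarrow> inv g \<otimes> (g \<otimes> x) = x"
  by (simp add: m_assoc[symmetric])

lemma (in group) cancel_inv_left:
  "\<lbrakk>g \<in> carrier G; x \<in> carrier G\<rbrakk> \<Longrightarrow> g \<otimes> (inv g \<otimes> x) = x"
  by (simp add: m_assoc[symmetric])

text \<open>The entry \<open>z\<close> is the one at which the partial sums reach \<open>t\<close>. Only the costs of the two parts
  around it are controlled; with \<open>t\<close> half of the total cost, each part costs at most half.\<close>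

lemma split_list_at_cost:
  fixes w :: "'a \<Rightarrow> real"
  assumes "xs \<noteq> []" "\<And>x. x \<in> set xs \<Longrightarrow> 0 \<le> w x" "0 \<le> t" "t \<le> sum_list (map w xs)"
  obtains ys z zs where "xs = ys @ z # zs" "sum_list (map w ys) \<le> t"
    "sum_list (map w zs) \<le> sum_list (map w xs) - t"
proof -
  have "\<exists>ys z zs. xs = ys @ z # zs \<and> sum_list (map w ys) \<le> t
      \<and> sum_list (map w zs) \<le> sum_list (map w xs) - t"
    using assms
  proof (induction xs arbitrary: t)
    case Nil
    then show ?case by simp
  next
    case (Cons x xs)
    show ?case
    proof (cases "t \<le> w x \<or> xs = []")
      case True
      then have "sum_list (map w xs) \<le> sum_list (map w (x # xs)) - t"
        using Cons.prems by auto
      then show ?thesis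
        using Cons.prems by (intro exI[of _ "[]"]) auto
    next
      case False
      then obtain ys z zs where "xs = ys @ z # zs" "sum_list (map w ys) \<le> t - w x"
          "sum_list (map w zs) \<le> sum_list (map w xs) - (t - w x)"
        using Cons.IH[of "t - w x"] Cons.prems by fastforce
      then show ?thesis
        by (intro exI[of _ "x # ys"] exI[of _ z] exI[of _ zs]) auto
    qed
  qed
  then show ?thesis
    using that by blast
qed

text \<open>The last axiom is a weak substitute for subadditivity, with products of three factors because
  a chain is split into two halves and one entry between them.\<close>

locale group_weight = group G for G (structure) +
  fixes w :: "'a \<Rightarrow> real"
  assumes w_nonneg: "x \<in> carrier G \<Longrightarrow> 0 \<le> w x"
    and w_one: "w \<one> = 0"
    and w_inv: "x \<in> carrier G \<Longrightarrow> w (inv x) = w x"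
    and w_conj: "\<lbrakk>g \<in> carrier G; x \<in> carrier G\<rbrakk> \<Longrightarrow> w (g \<otimes> x \<otimes> inv g) = w x"
    and w_triple: "\<lbrakk>x \<in> carrier G; y \<in> carrier G; z \<in> carrier G; w x \<le> t; w y \<le> t; w z \<le> t\<rbrakk>
      \<Longrightarrow> w (x \<otimes> y \<otimes> z) \<le> 2 * t"
begin

abbreviation chain_prod :: "'a list \<Rightarrow> 'a"
  where "chain_prod xs \<equiv> foldr (\<otimes>) xs \<one>"

abbreviation chain_cost :: "'a list \<Rightarrow> real"
  where "chain_cost xs \<equiv> sum_list (map w xs)"

definition chain_norm :: "'a \<Rightarrow> real"
  where "chain_norm x = (INF xs\<in>{xs. set xs \<subseteq> carrier G \<and> chain_prod xs = x}. chain_cost xs)"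

lemma chain_prod_closed: "set xs \<subseteq> carrier G \<Longrightarrow> chain_prod xs \<in> carrier G"
  by (induction xs) auto

lemma chain_prod_append:
  "\<lbrakk>set xs \<subseteq> carrier G; set ys \<subseteq> carrier G\<rbrakk>
    \<Longrightarrow> chain_prod (xs @ ys) = chain_prod xs \<otimes> chain_prod ys"
  by (induction xs) (auto simp: chain_prod_closed m_assoc)

lemma chain_prod_inv:
  "set xs \<subseteq> carrier G \<Longrightarrow> chain_prod (map (m_inv G) (rev xs)) = inv (chain_prod xs)"
proof (induction xs)
  case (Cons x xs)
  then have "set (map (m_inv G) (rev xs)) \<subseteq> carrier G"
    by auto
  then show ?case
    using Cons chain_prod_append[of "map (m_inv G) (rev xs)" "[inv x]"]
    by (simp add: chain_prod_closed inv_mult_group)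
qed simp

lemma chain_prod_conj:
  assumes "g \<in> carrier G" "set xs \<subseteq> carrier G"
  shows "chain_prod (map (\<lambda>x. g \<otimes> x \<otimes> inv g) xs) = g \<otimes> chain_prod xs \<otimes> inv g"
  using assms(2)
proof (induction xs)
  case (Cons x xs)
  have "(g \<otimes> x \<otimes> inv g) \<otimes> (g \<otimes> p \<otimes> inv g) = g \<otimes> (x \<otimes> p) \<otimes> inv g" if "p \<in> carrier G" for p
    using assms Cons.prems that by (simp add: m_assoc inv_cancel_left)
  then show ?case
    using Cons chain_prod_closed by simp
qed (use assms in simp)

lemma chain_cost_nonneg: "set xs \<subseteq> carrier G \<Longrightarrow> 0 \<le> chain_cost xs"
  by (intro sum_list_nonneg) (auto simp: w_nonneg)

text \<open>Frink's argument. Split the chain, of total cost \<open>S\<close>, into two parts of cost at most \<open>S / 2\<close> and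
  one entry between them. By induction the two partial products have weight at most \<open>S\<close>, as does the
  entry. The axiom for triple products then loses a factor of two only once, however long the
  chain is.\<close>

lemma weight_chain_prod_le:
  "set xs \<subseteq> carrier G \<Longrightarrow> w (chain_prod xs) \<le> 2 * chain_cost xs"
proof (induction xs rule: length_induct)
  case (1 xs)
  define S where "S = chain_cost xs"
  have S: "0 \<le> S"
    unfolding S_def using chain_cost_nonneg 1 by blast
  show ?case
  proof (cases "xs = []")
    case True
    then show ?thesis by (simp add: w_one)
  next
    case False
    obtain ys z zs where xs: "xs = ys @ z # zs" and ys: "chain_cost ys \<le> S / 2"
      and zs: "chain_cost zs \<le> S - S / 2"
      using split_list_at_cost[of xs w "S / 2"] False 1 S w_nonneg unfolding S_def by (auto simp: subset_iff)
    have sub: "set ys \<subseteq> carrier G" "z \<in> carrier G" "set zs \<subseteq> carrier G"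
      using 1 xs by auto
    have "w (chain_prod ys) \<le> 2 * chain_cost ys"
      using 1 sub xs by simp
    then have a: "w (chain_prod ys) \<le> S"
      using ys by simp
    have "w (chain_prod zs) \<le> 2 * chain_cost zs"
      using 1 sub xs by simp
    then have b: "w (chain_prod zs) \<le> S"
      using zs by simp
    have c: "w z \<le> S"
      using chain_cost_nonneg[OF sub(1)] chain_cost_nonneg[OF sub(3)] xs by (simp add: S_def)
    have "chain_prod xs = chain_prod ys \<otimes> z \<otimes> chain_prod zs"
      using sub xs chain_prod_append[of ys "z # zs"] by (simp add: chain_prod_closed m_assoc)
    then show ?thesis
      using w_triple[OF _ _ _ a c b] sub chain_prod_closed by (simp add: S_def)
  qed
qed

lemma chain_norm_le_cost: "set xs \<subseteq> carrier G \<Longrightarrow> chain_norm (chain_prod xs) \<le> chain_cost xs"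
  unfolding chain_norm_def
  by (intro cINF_lower bdd_belowI[of _ 0]) (auto intro: chain_cost_nonneg)

lemma chain_norm_greatest:
  assumes "x \<in> carrier G"
    and "\<And>xs. \<lbrakk>set xs \<subseteq> carrier G; chain_prod xs = x\<rbrakk> \<Longrightarrow> c \<le> chain_cost xs"
  shows "c \<le> chain_norm x"
proof -
  have "[x] \<in> {xs. set xs \<subseteq> carrier G \<and> chain_prod xs = x}"
    using assms(1) by simp
  then show ?thesis
    unfolding chain_norm_def using assms(2) by (intro cINF_greatest) blast+
qed

lemma chain_norm_le_weight: "x \<in> carrier G \<Longrightarrow> chain_norm x \<le> w x"
  using chain_norm_le_cost[of "[x]"] by simp

lemma weight_le_chain_norm: "x \<in> carrier G \<Longrightarrow> w x \<le> 2 * chain_norm x"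
  using chain_norm_greatest[of x "w x / 2"] weight_chain_prod_le by fastforce

lemma chain_norm_nonneg: "x \<in> carrier G \<Longrightarrow> 0 \<le> chain_norm x"
  using chain_norm_greatest chain_cost_nonneg by blast

lemma chain_norm_mult:
  assumes x: "x \<in> carrier G" and y: "y \<in> carrier G"
  shows "chain_norm (x \<otimes> y) \<le> chain_norm x + chain_norm y"
proof -
  have "chain_norm (x \<otimes> y) \<le> chain_cost xs + chain_cost ys"
    if "set xs \<subseteq> carrier G" "chain_prod xs = x" "set ys \<subseteq> carrier G" "chain_prod ys = y" for xs ys
    using chain_norm_le_cost[of "xs @ ys"] chain_prod_append[of xs ys] that by auto
  then have "chain_norm (x \<otimes> y) - chain_cost ys \<le> chain_norm x"
    if "set ys \<subseteq> carrier G" "chain_prod ys = y" for ys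
    using that by (intro chain_norm_greatest[OF x]) (simp add: algebra_simps)
  then have "chain_norm (x \<otimes> y) - chain_norm x \<le> chain_norm y"
    by (intro chain_norm_greatest[OF y]) (simp add: algebra_simps)
  then show ?thesis by simp
qed

lemma chain_norm_inv:
  assumes "x \<in> carrier G"
  shows "chain_norm (inv x) = chain_norm x"
proof -
  have le: "chain_norm (inv y) \<le> chain_norm y" if y: "y \<in> carrier G" for y
  proof (rule chain_norm_greatest[OF y])
    fix xs assume xs: "set xs \<subseteq> carrier G" "chain_prod xs = y"
    have "map w (map (m_inv G) (rev xs)) = rev (map w xs)"
      using xs w_inv by (auto simp: rev_map)
    then have "chain_cost (map (m_inv G) (rev xs)) = chain_cost xs"
      by (simp only: sum_list_rev)
    then show "chain_norm (inv y) \<le> chain_cost xs"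
      using chain_norm_le_cost[of "map (m_inv G) (rev xs)"] xs chain_prod_inv[of xs] by auto
  qed
  show ?thesis
    using le[of x] le[of "inv x"] assms by simp
qed

lemma chain_norm_conj:
  assumes g: "g \<in> carrier G" and x: "x \<in> carrier G"
  shows "chain_norm (g \<otimes> x \<otimes> inv g) = chain_norm x"
proof -
  have le: "chain_norm (h \<otimes> y \<otimes> inv h) \<le> chain_norm y"
    if h: "h \<in> carrier G" and y: "y \<in> carrier G" for h y
  proof (rule chain_norm_greatest[OF y])
    fix xs assume xs: "set xs \<subseteq> carrier G" "chain_prod xs = y"
    have "map w (map (\<lambda>x. h \<otimes> x \<otimes> inv h) xs) = map w xs"
      using xs h w_conj by auto
    then have "chain_cost (map (\<lambda>x. h \<otimes> x \<otimes> inv h) xs) = chain_cost xs"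
      by (simp only:)
    then show "chain_norm (h \<otimes> y \<otimes> inv h) \<le> chain_cost xs"
      using chain_norm_le_cost[of "map (\<lambda>x. h \<otimes> x \<otimes> inv h) xs"] xs h chain_prod_conj[OF h, of xs]
      by auto
  qed
  have "inv g \<otimes> (g \<otimes> x \<otimes> inv g) \<otimes> inv (inv g) = x"
    using g x by (simp add: m_assoc inv_cancel_left)
  then show ?thesis
    using le[OF g x] le[of "inv g" "g \<otimes> x \<otimes> inv g"] g x by simp
qed

end

section \<open>Bi-invariant metrics\<close>

locale bi_invariant_metric_group = group G + Metric_space "carrier G" d
  for G (structure) and d :: "'a \<Rightarrow> 'a \<Rightarrow> real" +
  assumes left_inv: "\<lbrakk>g \<in> carrier G; x \<in> carrier G; y \<in> carrier G\<rbrakk> \<Longrightarrow> d (g \<otimes> x) (g \<otimes> y) = d x y"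
    and right_inv: "\<lbrakk>g \<in> carrier G; x \<in> carrier G; y \<in> carrier G\<rbrakk> \<Longrightarrow> d (x \<otimes> g) (y \<otimes> g) = d x y"
begin

lemma dist_inverses:
  assumes x: "x \<in> carrier G" and y: "y \<in> carrier G"
  shows "d (inv x) (inv y) = d x y"
proof -
  have "d (inv x) (inv y) = d (x \<otimes> (inv x \<otimes> y)) (x \<otimes> (inv y \<otimes> y))"
    using x y by (simp only: left_inv right_inv inv_closed m_closed)
  also have "\<dots> = d y x"
    using x y by (simp add: cancel_inv_left)
  finally show ?thesis
    by (simp add: commute)
qed

lemma continuous_metric_group_structure_if_mcomplete:
  assumes "mcomplete" "\<And>x y. \<lbrakk>x \<in> carrier G; y \<in> carrier G\<rbrakk> \<Longrightarrow> d x y \<le> 1"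
  shows "continuous_metric_group_structure G d"
proof
  show "\<exists>\<gamma>\<^sub>1. is_modulus \<gamma>\<^sub>1 \<and>
      (\<forall>\<epsilon>>0. \<forall>x\<^sub>1\<in>carrier G. \<forall>x\<^sub>2\<in>carrier G.
        d x\<^sub>1 x\<^sub>2 < \<gamma>\<^sub>1 \<epsilon> \<longrightarrow> d (inv x\<^sub>1) (inv x\<^sub>2) < \<epsilon>)"
    by (rule exI[of _ id]) (auto simp: is_modulus_def dist_inverses)
  show "\<exists>\<gamma>\<^sub>2. is_modulus \<gamma>\<^sub>2 \<and>
      (\<forall>\<epsilon>>0. \<forall>x\<^sub>1\<in>carrier G. \<forall>x\<^sub>2\<in>carrier G. d x\<^sub>1 x\<^sub>2 < \<gamma>\<^sub>2 \<epsilon> \<longrightarrow>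
        (\<forall>y\<in>carrier G. max (d (x\<^sub>1 \<otimes> y) (x\<^sub>2 \<otimes> y)) (d (y \<otimes> x\<^sub>1) (y \<otimes> x\<^sub>2)) < \<epsilon>))"
    by (rule exI[of _ id]) (auto simp: is_modulus_def left_inv right_inv)
qed (use assms in auto)

text \<open>For a \<open>d\<close>-Cauchy sequence \<open>x\<close>, the set \<open>D k\<close> consists of the points around which the maps
  \<open>h \<mapsto> x m \<otimes> h\<close> are, from some \<open>m\<close> on, uniformly within \<open>1 / (k+1)\<close> of each other in \<open>\<rho>\<close>. It is open by definition.
  It is dense because, near any \<open>h0\<close>, there is an \<open>h\<close> that a late term \<open>x N\<close> carries to
  a point \<open>y = x n \<otimes> h0\<close> chosen \<^emph>\<open>before\<close> \<open>N\<close>: the ball around \<open>y\<close> of small \<open>\<rho>\<close>-diameter is fixed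
  first, and then \<open>N\<close> is taken so large that all later terms carry a neighbourhood of \<open>h\<close> into
  it. Right-invariance keeps the terms \<open>x m \<otimes> h\<close> together, left-invariance makes \<open>h\<close> close to \<open>h0\<close>.\<close>

lemma mcomplete_if_completely_metrizable:
  assumes "completely_metrizable_space mtopology"
  shows "mcomplete"
  unfolding mcomplete_def
proof (intro allI impI)
  fix x :: "nat \<Rightarrow> 'a" assume "MCauchy x"
  then have x [simp]: "\<And>n. x n \<in> carrier G"
    and Cauchy: "\<And>\<epsilon>. \<epsilon> > 0 \<Longrightarrow> \<exists>N. \<forall>m\<ge>N. \<forall>n\<ge>N. d (x m) (x n) < \<epsilon>"
    unfolding MCauchy_def by (blast, metis)
  obtain M \<rho> where \<rho>: "Metric_space M \<rho>" "Metric_space.mcomplete M \<rho>"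
      and top: "mtopology = Metric_space.mtopology M \<rho>"
    using assms unfolding completely_metrizable_space_def by blast
  interpret R: Metric_space M \<rho> by fact
  have M: "M = carrier G"
    using top topspace_mtopology R.topspace_mtopology by metis
  define D where "D k = \<Union>{U. openin mtopology U \<and>
      (\<exists>N. \<forall>h\<in>U. \<forall>m\<ge>N. \<forall>n\<ge>N. \<rho> (x m \<otimes> h) (x n \<otimes> h) < inverse (real (Suc k)))}" for k
  have open_D: "openin mtopology (D k)" for k
    unfolding D_def by (intro openin_Union) blast
  have dense_D: "Abstract_Topology.closure_of mtopology (D k) = topspace mtopology" for k
    unfolding dense_intersects_open
  proof (intro allI impI)
    fix W assume W: "openin mtopology W \<and> W \<noteq> {}"
    then obtain h0 \<epsilon> where h0: "h0 \<in> carrier G" and \<epsilon>: "\<epsilon> > 0" "mball h0 \<epsilon> \<subseteq> W"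
      by (metis all_not_in_conv openin_mtopology subsetD)
    obtain n where n: "\<And>m l. m \<ge> n \<Longrightarrow> l \<ge> n \<Longrightarrow> d (x m) (x l) < \<epsilon>"
      using Cauchy[OF \<epsilon>(1)] by blast
    define y where "y = x n \<otimes> h0"
    have y: "y \<in> carrier G"
      using h0 by (simp add: y_def)
    define e where "e = inverse (real (Suc k)) / 2"
    have "openin mtopology (R.mball y e)"
      unfolding top by (rule R.openin_mball)
    moreover have "y \<in> M"
      using y M by simp
    then have "y \<in> R.mball y e"
      by (simp add: e_def)
    ultimately obtain s where s: "s > 0" "mball y s \<subseteq> R.mball y e"
      unfolding openin_mtopology by blast
    obtain N0 where N0: "\<And>m l. m \<ge> N0 \<Longrightarrow> l \<ge> N0 \<Longrightarrow> d (x m) (x l) < s / 2"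
      using Cauchy[of "s / 2"] s by auto
    define N where "N = max n N0"
    define h where "h = inv (x N) \<otimes> y"
    have h: "h \<in> carrier G"
      using y by (simp add: h_def)
    have xNh: "x N \<otimes> h = y"
      using y by (simp add: h_def cancel_inv_left)
    \<comment> \<open>\<open>h\<close> is close to \<open>h0\<close> because \<open>x N\<close> is close to \<open>x n\<close>.\<close>
    have "d h0 h = d (x N \<otimes> h0) (x N \<otimes> h)"
      using h0 h by (simp add: left_inv)
    also have "\<dots> = d (x N) (x n)"
      using h0 by (simp add: xNh y_def right_inv)
    finally have hW: "h \<in> W"
      using n[of N n] h0 h \<epsilon> by (auto simp: N_def subset_iff)
    have ball: "x m \<otimes> g \<in> mball y s" if "g \<in> mball h (s / 2)" "m \<ge> N" for g m
    proof -
      have g: "g \<in> carrier G" "d h g < s / 2"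
        using that by auto
      have "d y (x m \<otimes> g) \<le> d (x N \<otimes> h) (x m \<otimes> h) + d (x m \<otimes> h) (x m \<otimes> g)"
        using triangle g h xNh y by (metis m_closed x)
      also have "\<dots> = d (x N) (x m) + d h g"
        using g h by (simp add: left_inv right_inv)
      also have "\<dots> < s"
        using N0[of N m] that g by (auto simp: N_def)
      finally show ?thesis
        using g y by simp
    qed
    have "\<rho> (x m \<otimes> g) (x l \<otimes> g) < inverse (real (Suc k))"
      if "g \<in> mball h (s / 2)" "m \<ge> N" "l \<ge> N" for g m l
    proof -
      have "x m \<otimes> g \<in> R.mball y e" "x l \<otimes> g \<in> R.mball y e"
        using ball that s by blast+
      then have "\<rho> (x m \<otimes> g) (x l \<otimes> g) < e + e"
        using R.triangle[of "x m \<otimes> g" y "x l \<otimes> g"] R.commute[of y "x m \<otimes> g"]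
        unfolding R.in_mball by linarith
      then show ?thesis
        by (simp add: e_def)
    qed
    then have "mball h (s / 2) \<subseteq> D k"
      unfolding D_def by (intro Union_upper) blast
    then have "h \<in> D k"
      using h s by auto
    then show "D k \<inter> W \<noteq> {}"
      using hW by blast
  qed
  have "Abstract_Topology.closure_of mtopology (\<Inter>(range D)) = topspace mtopology"
    using open_D dense_D assms by (intro Baire_category) auto
  moreover have "openin mtopology (carrier G)" "carrier G \<noteq> {}"
    using openin_topspace[of mtopology] one_closed by (auto simp only: topspace_mtopology)
  ultimately have "\<Inter>(range D) \<inter> carrier G \<noteq> {}"
    unfolding dense_intersects_open by blast
  then obtain g where g: "g \<in> carrier G" and gD: "\<And>k. g \<in> D k"
    by blast
  have "R.MCauchy (\<lambda>n. x n \<otimes> g)"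
    unfolding R.MCauchy_def
  proof (intro conjI allI impI)
    show "range (\<lambda>n. x n \<otimes> g) \<subseteq> M"
      using g M by auto
    fix \<epsilon> :: real assume "\<epsilon> > 0"
    then obtain k where k: "inverse (real (Suc k)) < \<epsilon>"
      using reals_Archimedean by blast
    obtain N where "\<forall>m\<ge>N. \<forall>n\<ge>N. \<rho> (x m \<otimes> g) (x n \<otimes> g) < inverse (real (Suc k))"
      using gD[of k] unfolding D_def by blast
    then show "\<exists>N. \<forall>n n'. N \<le> n \<longrightarrow> N \<le> n' \<longrightarrow> \<rho> (x n \<otimes> g) (x n' \<otimes> g) < \<epsilon>"
      using k by (meson less_trans)
  qed
  then obtain z where z: "limitin mtopology (\<lambda>n. x n \<otimes> g) z sequentially"
    using \<rho>(2) unfolding R.mcomplete_def top by blast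
  then have zc: "z \<in> carrier G"
    using limitin_topspace by fastforce
  have "d (x n) (z \<otimes> inv g) = d (x n \<otimes> g) z" for n
    using right_inv[of g "x n" "z \<otimes> inv g"] g zc by (simp add: m_assoc)
  then have "limitin mtopology x (z \<otimes> inv g) sequentially"
    using z g zc by (simp add: limit_metric_sequentially)
  then show "\<exists>l. limitin mtopology x l sequentially" ..
qed

end

section \<open>Invariant neighbourhoods of the identity\<close>

lemma (in group) invariant_under_inner_iff:
  assumes "V \<subseteq> carrier G"
  shows "invariant_under_inner G V \<longleftrightarrow> (\<forall>g\<in>carrier G. \<forall>x\<in>V. g \<otimes> x \<otimes> inv g \<in> V)"
proof
  assume "invariant_under_inner G V"
  then show "\<forall>g\<in>carrier G. \<forall>x\<in>V. g \<otimes> x \<otimes> inv g \<in> V"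
    unfolding invariant_under_inner_def by blast
next
  assume R: "\<forall>g\<in>carrier G. \<forall>x\<in>V. g \<otimes> x \<otimes> inv g \<in> V"
  show "invariant_under_inner G V"
    unfolding invariant_under_inner_def
  proof (intro ballI equalityI subsetI)
    fix g x assume g: "g \<in> carrier G" and x: "x \<in> V"
    have "x = g \<otimes> (inv g \<otimes> x \<otimes> inv (inv g)) \<otimes> inv g"
      using g x assms by (auto simp: m_assoc cancel_inv_left)
    moreover have "inv g \<otimes> x \<otimes> inv (inv g) \<in> V"
      using R g x by blast
    ultimately show "x \<in> (\<lambda>x. g \<otimes> x \<otimes> inv g) ` V"
      by blast
  qed (use R in blast)
qed

context topological_group
begin

lemma neighbourhood_subset_carrier: "neighbourhood T x U \<Longrightarrow> U \<subseteq> carrier G"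
  by (simp add: neighbourhood_def topspace_eq)

lemma one_in_neighbourhood: "neighbourhood T \<one> U \<Longrightarrow> \<one> \<in> U"
  unfolding neighbourhood_def by blast

lemma open_neighbourhood: "\<lbrakk>openin T U; x \<in> U\<rbrakk> \<Longrightarrow> neighbourhood T x U"
  unfolding neighbourhood_def using openin_subset by blast

lemma openin_left_translate:
  assumes "a \<in> carrier G" "openin T U"
  shows "openin T {z \<in> carrier G. a \<otimes> z \<in> U}"
proof -
  have "continuous_map T (prod_topology T T) (\<lambda>z. (a, z))"
    using assms by (simp add: continuous_map_pairwise o_def topspace_eq)
  then have "continuous_map T T (\<lambda>z. a \<otimes> z)"
    using continuous_map_compose[OF _ continuous_mult] by (fastforce simp: o_def)
  then show ?thesis
    using openin_continuous_map_preimage assms(2) topspace_eq by fastforce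
qed

lemma open_square_root:
  assumes "openin T U" "\<one> \<in> U"
  obtains W where "openin T W" "\<one> \<in> W" "\<And>x y. \<lbrakk>x \<in> W; y \<in> W\<rbrakk> \<Longrightarrow> x \<otimes> y \<in> U"
proof -
  let ?P = "{p \<in> topspace (prod_topology T T). (case p of (x, y) \<Rightarrow> x \<otimes> y) \<in> U}"
  have "openin (prod_topology T T) ?P" "(\<one>, \<one>) \<in> ?P"
    using openin_continuous_map_preimage[OF continuous_mult assms(1)] assms by (auto simp: topspace_eq)
  then obtain A B where "openin T A" "openin T B" "\<one> \<in> A" "\<one> \<in> B" "A \<times> B \<subseteq> ?P"
    unfolding openin_prod_topology_alt by meson
  then show ?thesis
    using that[of "A \<inter> B"] by (auto simp: subset_iff)
qed

text \<open>The SIN property is applied to a neighbourhood \<open>U2\<close> of \<open>\<one>\<close> with \<open>(U2 U2) (U2 U2) \<subseteq> U\<close>. Intersecting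
  the result with its image under inversion keeps it invariant, since inversion commutes with
  conjugation.\<close>

lemma SIN_shrink:
  assumes SIN: "SIN_group G T" and U: "neighbourhood T \<one> U"
  obtains V where "neighbourhood T \<one> V" "invariant_under_inner G V" "V \<subseteq> U"
    "\<And>x. x \<in> V \<Longrightarrow> inv x \<in> V"
    "\<And>x y z. \<lbrakk>x \<in> V; y \<in> V; z \<in> V\<rbrakk> \<Longrightarrow> x \<otimes> y \<otimes> z \<in> U"
proof -
  obtain U0 where U0: "openin T U0" "\<one> \<in> U0" "U0 \<subseteq> U"
    using U unfolding neighbourhood_def by blast
  obtain U1 where U1: "openin T U1" "\<one> \<in> U1" "\<And>x y. \<lbrakk>x \<in> U1; y \<in> U1\<rbrakk> \<Longrightarrow> x \<otimes> y \<in> U0"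
    using open_square_root[OF U0(1,2)] by blast
  obtain U2 where U2: "openin T U2" "\<one> \<in> U2" "\<And>x y. \<lbrakk>x \<in> U2; y \<in> U2\<rbrakk> \<Longrightarrow> x \<otimes> y \<in> U1"
    using open_square_root[OF U1(1,2)] by blast
  obtain V0 where V0: "neighbourhood T \<one> V0" "V0 \<subseteq> U2" "invariant_under_inner G V0"
    using SIN open_neighbourhood[OF U2(1,2)] unfolding SIN_group_def by blast
  define V where "V = {x \<in> V0. inv x \<in> V0}"
  have V0_carrier: "V0 \<subseteq> carrier G"
    using V0(1) by (rule neighbourhood_subset_carrier)
  have V_carrier: "V \<subseteq> carrier G"
    using V0_carrier by (auto simp: V_def)
  have U2_U1: "x \<in> U1" if "x \<in> V" for x
  proof -
    have "x \<otimes> \<one> \<in> U1"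
      using U2(2,3) that V0(2) by (auto simp: V_def)
    then show ?thesis
      using that V_carrier by auto
  qed
  obtain W where W: "openin T W" "\<one> \<in> W" "W \<subseteq> V0"
    using V0(1) unfolding neighbourhood_def by blast
  have "openin T (W \<inter> {x \<in> topspace T. inv x \<in> W})"
    using W(1) openin_continuous_map_preimage[OF continuous_inv W(1)] by blast
  moreover have "\<one> \<in> W \<inter> {x \<in> topspace T. inv x \<in> W}"
    using W(2) by (simp add: topspace_eq)
  ultimately have "neighbourhood T \<one> V"
    unfolding neighbourhood_def using W(3) V_carrier by (auto simp: V_def topspace_eq)
  moreover have "invariant_under_inner G V"
    unfolding invariant_under_inner_iff[OF V_carrier]
  proof (intro ballI)
    fix g x assume g: "g \<in> carrier G" and x: "x \<in> V"
    have "inv (g \<otimes> x \<otimes> inv g) = g \<otimes> inv x \<otimes> inv g"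
      using g x V_carrier by (auto simp: inv_mult_group m_assoc)
    then show "g \<otimes> x \<otimes> inv g \<in> V"
      using V0(3) g x unfolding invariant_under_inner_iff[OF V0_carrier] by (simp add: V_def)
  qed
  moreover have "inv x \<in> V" if "x \<in> V" for x
    using that V_carrier by (auto simp: V_def)
  moreover have triple: "x \<otimes> y \<otimes> z \<in> U" if "x \<in> V" "y \<in> V" "z \<in> V" for x y z
    using U0(3) U1(3) U2(3) V0(2) U2_U1 that by (auto simp: V_def subset_iff)
  moreover have "V \<subseteq> U"
  proof
    fix x assume "x \<in> V"
    moreover have "\<one> \<in> V"
      using one_in_neighbourhood[OF V0(1)] by (simp add: V_def)
    ultimately show "x \<in> U"
      using triple[of x \<one> \<one>] V_carrier by auto
  qed
  ultimately show ?thesis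
    using that by blast
qed

text \<open>Left-invariance gives \<open>d \<one> (g x g\<^sup>-\<^sup>1) = d g\<^sup>-\<^sup>1 (x g\<^sup>-\<^sup>1)\<close>, and this is the displacement of the pair
  \<open>\<one>, x\<close> under a right translation, which the modulus bounds uniformly in \<open>g\<close>.\<close>

lemma SIN_if_continuous_left_invariant_metric:
  assumes "continuous_metric_group_structure G d" "left_invariant G d"
    and "Metric_space.mtopology (carrier G) d = T"
  shows "SIN_group G T"
  unfolding SIN_group_def
proof (intro conjI allI impI)
  show "topological_group G T" by (rule topological_group_axioms)
  interpret continuous_metric_group_structure G d by fact
  have top: "mtopology = T" by fact
  fix U assume "neighbourhood T \<one> U"
  then obtain W where W: "openin mtopology W" "\<one> \<in> W" "W \<subseteq> U"
    unfolding neighbourhood_def top by blast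
  then obtain \<epsilon> where "\<epsilon> > 0" "mball \<one> \<epsilon> \<subseteq> W"
    unfolding openin_mtopology by meson
  then have \<epsilon>: "\<epsilon> > 0" "mball \<one> \<epsilon> \<subseteq> U"
    using W(3) by auto
  obtain \<gamma> where \<gamma>: "is_modulus \<gamma>"
    "\<forall>\<epsilon>>0. \<forall>x\<in>carrier G. \<forall>y\<in>carrier G. d x y < \<gamma> \<epsilon> \<longrightarrow>
      (\<forall>z\<in>carrier G. max (d (x \<otimes> z) (y \<otimes> z)) (d (z \<otimes> x) (z \<otimes> y)) < \<epsilon>)"
    using uniform_mult by blast
  define \<delta> where "\<delta> = \<gamma> \<epsilon>"
  have \<delta>: "\<delta> > 0" "\<And>x y z. \<lbrakk>x \<in> carrier G; y \<in> carrier G; z \<in> carrier G; d x y < \<delta>\<rbrakk>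
      \<Longrightarrow> d (x \<otimes> z) (y \<otimes> z) < \<epsilon>"
    using \<gamma> \<epsilon>(1) by (auto simp: is_modulus_def \<delta>_def)
  define V where "V = {g \<otimes> x \<otimes> inv g |g x. g \<in> carrier G \<and> x \<in> mball \<one> \<delta>}"
  have V_carrier: "V \<subseteq> carrier G"
    by (auto simp: V_def)
  have ball_V: "mball \<one> \<delta> \<subseteq> V"
  proof
    fix x assume x: "x \<in> mball \<one> \<delta>"
    then have "x = \<one> \<otimes> x \<otimes> inv \<one>"
      by simp
    then show "x \<in> V"
      unfolding V_def using x by blast
  qed
  have "openin T (mball \<one> \<delta>)"
    using openin_mball[of \<one> \<delta>] unfolding top .
  moreover have "\<one> \<in> mball \<one> \<delta>"
    using \<delta>(1) by simp
  ultimately have "neighbourhood T \<one> V"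
    unfolding neighbourhood_def topspace_eq using V_carrier ball_V by blast
  moreover have "V \<subseteq> U"
  proof
    fix v assume "v \<in> V"
    then obtain g x where v: "v = g \<otimes> x \<otimes> inv g" and g: "g \<in> carrier G"
      and x: "x \<in> carrier G" "d \<one> x < \<delta>"
      unfolding V_def by auto
    have "d \<one> v = d (g \<otimes> (\<one> \<otimes> inv g)) (g \<otimes> (x \<otimes> inv g))"
      using g x v by (simp add: m_assoc)
    also have "\<dots> = d (\<one> \<otimes> inv g) (x \<otimes> inv g)"
      using assms(2) g x unfolding left_invariant_def by (meson inv_closed m_closed one_closed)
    also have "\<dots> < \<epsilon>"
      using x g by (intro \<delta>(2)) auto
    finally show "v \<in> U"
      using \<epsilon>(2) v g x by auto
  qed
  moreover have "invariant_under_inner G V"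
    unfolding invariant_under_inner_iff[OF V_carrier]
  proof (intro ballI)
    fix h v assume h: "h \<in> carrier G" and "v \<in> V"
    then obtain g x where v: "v = g \<otimes> x \<otimes> inv g" and g: "g \<in> carrier G" and x: "x \<in> mball \<one> \<delta>"
      unfolding V_def by auto
    have "h \<otimes> v \<otimes> inv h = (h \<otimes> g) \<otimes> x \<otimes> inv (h \<otimes> g)"
      using v h g x by (simp add: m_assoc inv_mult_group)
    then show "h \<otimes> v \<otimes> inv h \<in> V"
      unfolding V_def using h g x by blast
  qed
  ultimately show "\<exists>V. neighbourhood T \<one> V \<and> V \<subseteq> U \<and> invariant_under_inner G V"
    by blast
qed

end

section \<open>A bi-invariant metric from invariant neighbourhoods\<close>

locale invariant_neighbourhood_chain = topological_group G T
  for G (structure) and T :: "'a topology" +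
  fixes V :: "nat \<Rightarrow> 'a set"
  assumes V_zero: "V 0 = carrier G"
    and V_neighbourhood: "neighbourhood T \<one> (V n)"
    and V_invariant: "invariant_under_inner G (V n)"
    and V_inv: "x \<in> V n \<Longrightarrow> inv x \<in> V n"
    and V_triple: "\<lbrakk>x \<in> V (Suc n); y \<in> V (Suc n); z \<in> V (Suc n)\<rbrakk> \<Longrightarrow> x \<otimes> y \<otimes> z \<in> V n"
    and V_base: "neighbourhood T \<one> U \<Longrightarrow> \<exists>n. V n \<subseteq> U"
    and V_separates: "(\<And>n. x \<in> V n) \<Longrightarrow> x = \<one>"
begin

lemma V_carrier: "V n \<subseteq> carrier G"
  using V_neighbourhood by (rule neighbourhood_subset_carrier)

lemma one_in_V: "\<one> \<in> V n"
  using V_neighbourhood by (rule one_in_neighbourhood)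

lemma V_antimono: "m \<le> n \<Longrightarrow> V n \<subseteq> V m"
proof (induction n rule: dec_induct)
  case (step n)
  have "V (Suc n) \<subseteq> V n"
  proof
    fix x assume "x \<in> V (Suc n)"
    then show "x \<in> V n"
      using V_triple[of x n \<one> \<one>] one_in_V[of "Suc n"] V_carrier[of "Suc n"] by auto
  qed
  then show ?case
    using step by blast
qed simp

lemma V_inv_iff: "x \<in> carrier G \<Longrightarrow> inv x \<in> V n \<longleftrightarrow> x \<in> V n"
  using V_inv[of x n] V_inv[of "inv x" n] by auto

lemma V_conj_iff:
  assumes "g \<in> carrier G" "x \<in> carrier G"
  shows "g \<otimes> x \<otimes> inv g \<in> V n \<longleftrightarrow> x \<in> V n"
proof -
  have conj: "h \<otimes> y \<otimes> inv h \<in> V n" if "h \<in> carrier G" "y \<in> V n" for h y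
    using V_invariant[of n] that unfolding invariant_under_inner_iff[OF V_carrier] by blast
  have "inv g \<otimes> (g \<otimes> x \<otimes> inv g) \<otimes> inv (inv g) = x"
    using assms by (simp add: m_assoc inv_cancel_left)
  then show ?thesis
    using conj[of g x] conj[of "inv g" "g \<otimes> x \<otimes> inv g"] assms by auto
qed

text \<open>Since \<open>V 0\<close> is the whole group, the infimum is over a nonempty set at every point of the
  group.\<close>

definition weight :: "'a \<Rightarrow> real"
  where "weight x = (INF n\<in>{n. x \<in> V n}. (1/2) ^ n)"

lemma weight_le: "x \<in> V n \<Longrightarrow> weight x \<le> (1/2) ^ n"
  unfolding weight_def by (intro cINF_lower bdd_belowI[of _ 0]) auto

lemma weight_nonneg: "x \<in> carrier G \<Longrightarrow> 0 \<le> weight x"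
  unfolding weight_def using V_zero by (intro cINF_greatest) auto

lemma in_V_if_weight_less:
  assumes "x \<in> carrier G" "weight x < (1/2) ^ n"
  shows "x \<in> V (Suc n)"
proof -
  have "\<exists>m\<in>{m. x \<in> V m}. (1/2) ^ m < ((1/2) ^ n :: real)"
    using assms V_zero unfolding weight_def
    by (subst (asm) cINF_less_iff) (auto intro: bdd_belowI[of _ 0])
  then obtain m where m: "x \<in> V m" "(1/2) ^ m < ((1/2) ^ n :: real)"
    by blast
  then have "Suc n \<le> m"
    using power_decreasing[of m n "1/2 :: real"] by (simp add: not_less_eq_eq[symmetric] del: power_divide)
  then show ?thesis
    using V_antimono m(1) by blast
qed

lemma weight_eq_0: "weight x = 0 \<Longrightarrow> x \<in> carrier G \<Longrightarrow> x = \<one>"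
proof (rule V_separates)
  fix n assume "weight x = 0" "x \<in> carrier G"
  then show "x \<in> V n"
    using in_V_if_weight_less[of x n] V_antimono[of n "Suc n"] by auto
qed

sublocale group_weight G weight
proof
  show "weight \<one> = 0"
  proof (rule antisym)
    have "(\<lambda>n. (1/2) ^ n :: real) \<longlonglongrightarrow> 0"
      by (rule LIMSEQ_power_zero) simp
    then show "weight \<one> \<le> 0"
      by (rule LIMSEQ_le_const) (use weight_le one_in_V in blast)
  qed (simp add: weight_nonneg)
  \<comment> \<open>Let \<open>n\<close> be the last index with \<open>x \<otimes> y \<otimes> z \<in> V n\<close>. If the weight of the product exceeds \<open>2 * t\<close>,
    then \<open>t\<close> is so small that the three factors lie in \<open>V (n+2)\<close>, and the product lies in \<open>V (n+1)\<close>.\<close>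
  show "weight (x \<otimes> y \<otimes> z) \<le> 2 * t"
    if xyz: "x \<in> carrier G" "y \<in> carrier G" "z \<in> carrier G"
      and t: "weight x \<le> t" "weight y \<le> t" "weight z \<le> t" for x y z t
  proof (rule ccontr)
    let ?u = "x \<otimes> y \<otimes> z"
    assume "\<not> weight ?u \<le> 2 * t"
    then have less: "2 * t < weight ?u" by simp
    have u: "?u \<in> carrier G"
      using xyz by simp
    have "0 \<le> t"
      using weight_nonneg[OF xyz(1)] t(1) by simp
    then have "?u \<noteq> \<one>"
      using less \<open>weight \<one> = 0\<close> by auto
    then obtain m where m: "?u \<notin> V m"
      using V_separates by blast
    define k where "k = (LEAST m. ?u \<notin> V m)"
    have k: "?u \<notin> V k"
      unfolding k_def using m by (rule LeastI)
    then have "k \<noteq> 0"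
      using u V_zero by metis
    then obtain n where n: "k = Suc n"
      using not0_implies_Suc by blast
    have "?u \<in> V n"
      using not_less_Least[of n "\<lambda>m. ?u \<notin> V m"] n by (auto simp: k_def)
    then have "t < (1/2) ^ Suc n"
      using weight_le[of ?u n] less by simp
    then have "x \<in> V (Suc (Suc n))" "y \<in> V (Suc (Suc n))" "z \<in> V (Suc (Suc n))"
      using xyz t by (intro in_V_if_weight_less; simp)+
    then show False
      using V_triple k n by blast
  qed
  show "weight (inv x) = weight x" if "x \<in> carrier G" for x
    using that by (simp add: weight_def V_inv_iff)
  show "weight (g \<otimes> x \<otimes> inv g) = weight x" if "g \<in> carrier G" "x \<in> carrier G" for g x
    using that by (simp add: weight_def V_conj_iff)
qed (rule weight_nonneg)

text \<open>Symmetry and nonnegativity are demanded of a metric also outside its carrier, where \<open>inv\<close> is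
  unspecified; the value \<open>0\<close> there ensures both.\<close>

definition chain_dist :: "'a \<Rightarrow> 'a \<Rightarrow> real"
  where "chain_dist x y = (if x \<in> carrier G \<and> y \<in> carrier G then chain_norm (inv x \<otimes> y) else 0)"

lemma chain_norm_less_imp_in_V:
  "\<lbrakk>x \<in> carrier G; chain_norm x < (1/2) ^ Suc n\<rbrakk> \<Longrightarrow> x \<in> V n"
  using weight_le_chain_norm[of x] in_V_if_weight_less[of x n] V_antimono[of n "Suc n"] by auto

lemma in_V_imp_chain_norm_le: "x \<in> V n \<Longrightarrow> chain_norm x \<le> (1/2) ^ n"
  using chain_norm_le_weight[of x] weight_le[of x n] V_carrier by force

sublocale bi_invariant_metric_group G chain_dist
proof
  show "0 \<le> chain_dist x y" for x y
    by (simp add: chain_dist_def chain_norm_nonneg)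
  show "chain_dist x y = chain_dist y x" for x y
  proof (cases "x \<in> carrier G \<and> y \<in> carrier G")
    case True
    then show ?thesis
      using chain_norm_inv[of "inv x \<otimes> y"] by (simp add: chain_dist_def inv_mult_group)
  qed (auto simp: chain_dist_def)
  show "chain_dist x y = 0 \<longleftrightarrow> x = y" if "x \<in> carrier G" "y \<in> carrier G" for x y
  proof
    assume "chain_dist x y = 0"
    then have "weight (inv x \<otimes> y) = 0"
      using weight_le_chain_norm[of "inv x \<otimes> y"] weight_nonneg[of "inv x \<otimes> y"] that
      by (simp add: chain_dist_def)
    then have "inv x \<otimes> y = \<one>"
      using weight_eq_0 that by simp
    then show "x = y"
      using that inv_solve_left'[of \<one> x y] by simp
  next
    assume "x = y"
    then show "chain_dist x y = 0"
      using chain_norm_le_weight[of \<one>] chain_norm_nonneg[of \<one>] w_one that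
      by (simp add: chain_dist_def)
  qed
  show "chain_dist x z \<le> chain_dist x y + chain_dist y z"
    if "x \<in> carrier G" "y \<in> carrier G" "z \<in> carrier G" for x y z
  proof -
    have "inv x \<otimes> z = (inv x \<otimes> y) \<otimes> (inv y \<otimes> z)"
      using that by (simp add: m_assoc cancel_inv_left)
    then show ?thesis
      using chain_norm_mult[of "inv x \<otimes> y" "inv y \<otimes> z"] that by (simp add: chain_dist_def)
  qed
  show "chain_dist (g \<otimes> x) (g \<otimes> y) = chain_dist x y"
    if "g \<in> carrier G" "x \<in> carrier G" "y \<in> carrier G" for g x y
    using that by (simp add: chain_dist_def inv_mult_group m_assoc inv_cancel_left)
  show "chain_dist (x \<otimes> g) (y \<otimes> g) = chain_dist x y"
    if "g \<in> carrier G" "x \<in> carrier G" "y \<in> carrier G" for g x y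
    using that chain_norm_conj[of "inv g" "inv x \<otimes> y"]
    by (simp add: chain_dist_def inv_mult_group m_assoc)
qed

lemma chain_dist_le_1: "\<lbrakk>x \<in> carrier G; y \<in> carrier G\<rbrakk> \<Longrightarrow> chain_dist x y \<le> 1"
  using in_V_imp_chain_norm_le[of "inv x \<otimes> y" 0] V_zero by (simp add: chain_dist_def)

text \<open>Balls about \<open>\<one>\<close> and the sets \<open>V n\<close> are cofinal in each other by the two-sided comparison of norm and
  weight. Left translations are homeomorphisms for \<open>T\<close> and isometries for the metric, and carry this to
  every other point.\<close>

lemma mtopology_chain_dist: "mtopology = T"
  unfolding topology_eq
proof (intro allI iffI)
  fix U assume U: "openin T U"
  show "openin mtopology U"
    unfolding openin_mtopology
  proof (intro conjI allI impI)
    show "U \<subseteq> carrier G"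
      using openin_subset[OF U] topspace_eq by simp
    fix x assume "x \<in> U"
    with \<open>U \<subseteq> carrier G\<close> have x: "x \<in> carrier G" by blast
    have "neighbourhood T \<one> {z \<in> carrier G. x \<otimes> z \<in> U}"
      using openin_left_translate[OF x U] \<open>x \<in> U\<close> x by (intro open_neighbourhood) auto
    then obtain n where n: "V n \<subseteq> {z \<in> carrier G. x \<otimes> z \<in> U}"
      using V_base by blast
    have "mball x ((1/2) ^ Suc n) \<subseteq> U"
    proof
      fix y assume "y \<in> mball x ((1/2) ^ Suc n)"
      then have y: "y \<in> carrier G" "chain_norm (inv x \<otimes> y) < (1/2) ^ Suc n"
        using x by (auto simp: chain_dist_def)
      then have "inv x \<otimes> y \<in> V n"
        using x by (intro chain_norm_less_imp_in_V) auto
      then have "x \<otimes> (inv x \<otimes> y) \<in> U"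
        using n by blast
      then show "y \<in> U"
        using x y by (simp add: cancel_inv_left)
    qed
    then show "\<exists>r>0. mball x r \<subseteq> U"
      by (intro exI[of _ "(1/2) ^ Suc n"]) auto
  qed
next
  fix U assume "openin mtopology U"
  then have U: "U \<subseteq> carrier G" "\<And>x. x \<in> U \<Longrightarrow> \<exists>r>0. mball x r \<subseteq> U"
    unfolding openin_mtopology by auto
  show "openin T U"
  proof (subst openin_subopen, intro ballI)
    fix x assume "x \<in> U"
    then obtain r where r: "r > 0" "mball x r \<subseteq> U" and x: "x \<in> carrier G"
      using U by blast
    obtain n where n: "(1/2) ^ n < r"
      using real_arch_pow_inv[OF r(1), of "1/2"] by auto
    obtain W where W: "openin T W" "\<one> \<in> W" "W \<subseteq> V n"
      using V_neighbourhood[of n] unfolding neighbourhood_def by blast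
    let ?W = "{y \<in> carrier G. inv x \<otimes> y \<in> W}"
    have "openin T ?W" "x \<in> ?W"
      using openin_left_translate[of "inv x"] W x by auto
    moreover have "?W \<subseteq> mball x r"
    proof
      fix y assume "y \<in> ?W"
      then show "y \<in> mball x r"
        using in_V_imp_chain_norm_le[of "inv x \<otimes> y" n] W(3) n x by (auto simp: chain_dist_def)
    qed
    ultimately show "\<exists>W. openin T W \<and> x \<in> W \<and> W \<subseteq> U"
      using r(2) by blast
  qed
qed

end

text \<open>The sets are chosen one after the other. Keeping \<open>V (n+1)\<close> inside the ball of radius \<open>2\<^sup>-\<^sup>n\<close> of a
  metric for \<open>T\<close>, which need not be related to the group structure, makes them a base.\<close>

lemma (in topological_group) SIN_neighbourhood_chain:
  assumes SIN: "SIN_group G T" and "metrizable_space T"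
  obtains V where "invariant_neighbourhood_chain G T V"
proof -
  obtain M \<rho> where "Metric_space M \<rho>" and top: "T = Metric_space.mtopology M \<rho>"
    using assms(2) unfolding metrizable_space_def by blast
  then interpret R: Metric_space M \<rho> by simp
  have M: "M = carrier G"
    using topspace_eq R.topspace_mtopology top by simp
  define P where "P n W \<longleftrightarrow> neighbourhood T \<one> W \<and> invariant_under_inner G W \<and> (\<forall>x\<in>W. inv x \<in> W)
      \<and> (n = 0 \<longrightarrow> W = carrier G)" for n :: nat and W
  define Q where "Q n W W' \<longleftrightarrow> (\<forall>x\<in>W'. \<forall>y\<in>W'. \<forall>z\<in>W'. x \<otimes> y \<otimes> z \<in> W) \<and> W' \<subseteq> R.mball \<one> ((1/2) ^ n)"
    for n W W'
  have "\<exists>V. \<forall>n. P n (V n) \<and> Q n (V n) (V (Suc n))"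
  proof (rule dependent_nat_choice)
    have "openin T (carrier G)"
      using openin_topspace[of T] topspace_eq by simp
    then have "P 0 (carrier G)"
      unfolding P_def by (simp add: open_neighbourhood invariant_under_inner_iff)
    then show "\<exists>W. P 0 W" ..
  next
    fix W n assume "P n W"
    then obtain W0 where W0: "openin T W0" "\<one> \<in> W0" "W0 \<subseteq> W"
      unfolding P_def neighbourhood_def by blast
    have "openin T (W0 \<inter> R.mball \<one> ((1/2) ^ n))"
      using W0(1) R.openin_mball unfolding top by blast
    moreover have "\<one> \<in> M"
      using M by simp
    then have "\<one> \<in> W0 \<inter> R.mball \<one> ((1/2) ^ n)"
      using W0(2) by simp
    ultimately have "neighbourhood T \<one> (W0 \<inter> R.mball \<one> ((1/2) ^ n))"
      by (rule open_neighbourhood)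
    from SIN_shrink[OF SIN this] obtain W' where
      "neighbourhood T \<one> W'" "invariant_under_inner G W'" "W' \<subseteq> W0 \<inter> R.mball \<one> ((1/2) ^ n)"
      "\<And>x. x \<in> W' \<Longrightarrow> inv x \<in> W'"
      "\<And>x y z. \<lbrakk>x \<in> W'; y \<in> W'; z \<in> W'\<rbrakk> \<Longrightarrow> x \<otimes> y \<otimes> z \<in> W0 \<inter> R.mball \<one> ((1/2) ^ n)"
      by metis
    then have "P (Suc n) W' \<and> Q n W W'"
      unfolding P_def Q_def using W0(3) by blast
    then show "\<exists>W'. P (Suc n) W' \<and> Q n W W'" ..
  qed
  then obtain V where PV: "\<And>n. P n (V n)" and QV: "\<And>n. Q n (V n) (V (Suc n))"
    by blast
  have base: "\<exists>n. V n \<subseteq> U" if U: "neighbourhood T \<one> U" for U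
  proof -
    obtain W where W: "openin R.mtopology W" "\<one> \<in> W" "W \<subseteq> U"
      using U unfolding neighbourhood_def top by blast
    then obtain r where r: "r > 0" "R.mball \<one> r \<subseteq> U"
      unfolding R.openin_mtopology by (meson order_trans)
    obtain n where n: "(1/2) ^ n < r"
      using real_arch_pow_inv[OF r(1), of "1/2"] by auto
    have "V (Suc n) \<subseteq> R.mball \<one> ((1/2) ^ n)"
      using QV[of n] by (simp add: Q_def)
    also have "\<dots> \<subseteq> U"
      using R.mball_subset_concentric[of "(1/2) ^ n" r \<one>] n r(2) by simp
    finally show ?thesis ..
  qed
  have "invariant_neighbourhood_chain G T V"
  proof
    fix x assume x: "\<And>n. x \<in> V n"
    have xc: "x \<in> carrier G"
      using x[of 0] PV[of 0] by (simp add: P_def)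
    show "x = \<one>"
    proof (rule ccontr)
      assume "x \<noteq> \<one>"
      have "Hausdorff_space T"
        using assms(2) by (rule metrizable_imp_Hausdorff_space)
      then have "closedin T {x}"
        using xc topspace_eq by (simp add: closedin_Hausdorff_sing_eq)
      then have "openin T (topspace T - {x})"
        by (rule openin_diff[OF openin_topspace])
      moreover have "\<one> \<in> topspace T - {x}"
        using \<open>x \<noteq> \<one>\<close> by (simp add: topspace_eq)
      ultimately show False
        using base[OF open_neighbourhood] x by blast
    qed
  qed (use PV QV base in \<open>auto simp: P_def Q_def\<close>)
  then show ?thesis
    by (rule that)
qed

theorem proposition4:
  fixes G :: "('a, 'b) monoid_scheme" and T :: "'a topology"
  assumes "topological_group G T"
    and "completely_metrizable_space T"
  shows "(\<exists>d. Metric_space (carrier G) d \<and> left_invariant G d \<and>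
              Metric_space.mtopology (carrier G) d = T \<and>
              continuous_metric_group_structure G d)
         \<longleftrightarrow> SIN_group G T"
proof
  assume "\<exists>d. Metric_space (carrier G) d \<and> left_invariant G d \<and>
              Metric_space.mtopology (carrier G) d = T \<and>
              continuous_metric_group_structure G d"
  then show "SIN_group G T"
    using topological_group.SIN_if_continuous_left_invariant_metric[OF assms(1)] by blast
next
  assume "SIN_group G T"
  then obtain V where "invariant_neighbourhood_chain G T V"
    using topological_group.SIN_neighbourhood_chain[OF assms(1)]
      completely_metrizable_imp_metrizable_space[OF assms(2)] by blast
  then interpret invariant_neighbourhood_chain G T V .
  have "mcomplete"
    using mcomplete_if_completely_metrizable assms(2) by (simp add: mtopology_chain_dist)
  then have "continuous_metric_group_structure G chain_dist"
    using continuous_metric_group_structure_if_mcomplete chain_dist_le_1 by blast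
  moreover have "left_invariant G chain_dist"
    unfolding left_invariant_def using left_inv by blast
  ultimately show "\<exists>d. Metric_space (carrier G) d \<and> left_invariant G d \<and>
              Metric_space.mtopology (carrier G) d = T \<and>
              continuous_metric_group_structure G d"
    using Metric_space_axioms mtopology_chain_dist by blast
qed

end
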